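(* In any $n$-to-1 parity-oblivious multiplexing scenario, the success rate $s$ and the robustness of contextuality to depolarisation $r_{min}^{depol}$ are monotonically equivalent resource quantifiers via the relation $$r_{min}^{depol}=\frac{s-s_{NC}}{s-\frac12},\qquad s_{NC}=\frac12\left(1+\frac1n\right).$$ That is, this relation holds, and through it (for fixed $n$) a higher robustness of contextuality to depolarisation corresponds to a higher success rate, and vice versa.
   Context: In an $n$-to-1 parity-oblivious multiplexing (POM) scenario, each bitstring $x=(x_1,\dots,x_n)\in X_n:=\{0,1\}^n$ is encoded in a preparation $P_x$ of a quantum state, given by a density operator $\rho_x$ on a finite-dimensional Hilbert space $\mathcal{H}$. For each $y\in\{1,\dots,n\}$ there is a binary measurement $M_y$, given by a two-outcome POVM $\{E_{0|M_y},E_{1|M_y}\}$ on $\mathcal{H}$ (so $E_{k|M_y}\ge 0$ and $E_{0|M_y}+E_{1|M_y}=\mathbb{1}$), whose outcome $k$ is meant to reveal the $y$-th bit $x_y$. The statistics are $p(k|M_y,P_x)=\mathrm{Tr}(E_{k|M_y}\rho_x)$. They are required to satisfy parity-obliviousness (no information about the parity of any subset of the string with more than one bit can be recovered from a single measurement): for every $t\in\{0,1\}^n$ with $\sum_i t_i\ge 2$, every $y$ and every outcome $k\in\{0,1\}$, $$\sum_{x:\,x\cdot t=0}p(k|M_y,P_x)=\sum_{x:\,x\cdot t=1}p(k|M_y,P_x),$$ where $x\cdot t=\sum_i x_it_i$ modulo 2. The success rate of the scenario is $$s=\frac{1}{2^n n}\sum_{y=1}^n\sum_{x\in X_n}p(k=x_y|M_y,P_x).$$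 The number $s_{NC}=\frac12\left(1+\frac1n\right)$ is the optimal success rate achievable by noncontextual (classical) realisations of the task. Partial depolarising noise of strength $r\in[0,1]$ replaces every state $\rho_x$ by $(1-r)\rho_x+r\mu$, where $\mu=\mathbb{1}/\dim\mathcal{H}$ is the maximally mixed state, leaving the measurements unchanged. The robustness of contextuality to depolarisation $r_{min}^{depol}$ is the minimum partial depolarising noise to be added to the scenario such that its depolarised version performs as poorly as a noncontextual realisation, i.e. the minimum $r$ such that the success rate of the depolarised scenario is the optimal noncontextual one, $s_{NC}$. *)

theory Defs
  imports "Jordan_Normal_Form.Schur_Decomposition" "HOL-Library.FuncSet"
begin

text \<open>
  A finite-dimensional Hilbert space is represented as the space of complex vectors of
  length \<open>d \<ge> 1\<close>, and operators on it as complex \<open>d \<times> d\<close> matrices.  The dimension is a component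
  of the scenario, so scenarios on different Hilbert spaces have the same type.
\<close>

definition mat_trace :: "complex mat \<Rightarrow> complex" where
  "mat_trace A = (\<Sum>i<dim_row A. A $$ (i, i))"

text \<open>For self-adjoint \<open>A\<close> the number \<open>(A *\<^sub>v v) \<bullet>c v\<close> is real, so taking \<open>Re\<close> loses nothing.\<close>

definition psd :: "nat \<Rightarrow> complex mat \<Rightarrow> bool" where
  "psd d A \<longleftrightarrow> A \<in> carrier_mat d d \<and> mat_adjoint A = A \<and>
     (\<forall>v \<in> carrier_vec d. 0 \<le> Re ((A *\<^sub>v v) \<bullet>c v))"

definition density_operator :: "nat \<Rightarrow> complex mat \<Rightarrow> bool" where
  "density_operator d \<rho> \<longleftrightarrow> psd d \<rho> \<and> mat_trace \<rho> = 1"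

definition binary_povm :: "nat \<Rightarrow> (nat \<Rightarrow> complex mat) \<Rightarrow> bool" where
  "binary_povm d E \<longleftrightarrow> psd d (E 0) \<and> psd d (E 1) \<and> E 0 + E 1 = 1\<^sub>m d"

definition bitstrings :: "nat \<Rightarrow> (nat \<Rightarrow> nat) set" where
  "bitstrings n = {1..n} \<rightarrow>\<^sub>E {0, 1}"

definition parity :: "nat \<Rightarrow> (nat \<Rightarrow> nat) \<Rightarrow> (nat \<Rightarrow> nat) \<Rightarrow> nat" where
  "parity n x t = (\<Sum>i = 1..n. x i * t i) mod 2"

text \<open>\<open>state S x\<close> is \<open>\<rho>\<^sub>x\<close>, and \<open>effect S y k\<close> is the effect of outcome \<open>k\<close> of measurement \<open>M\<^sub>y\<close>.\<close>

record scenario =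
  hdim :: nat
  state :: "(nat \<Rightarrow> nat) \<Rightarrow> complex mat"
  effect :: "nat \<Rightarrow> nat \<Rightarrow> complex mat"

text \<open>The trace below is real whenever both factors are positive semidefinite.\<close>

definition prob :: "scenario \<Rightarrow> nat \<Rightarrow> nat \<Rightarrow> (nat \<Rightarrow> nat) \<Rightarrow> real" where
  "prob S k y x = Re (mat_trace (effect S y k * state S x))"

definition parity_oblivious :: "nat \<Rightarrow> scenario \<Rightarrow> bool" where
  "parity_oblivious n S \<longleftrightarrow>
     (\<forall>t \<in> bitstrings n. 2 \<le> (\<Sum>i = 1..n. t i) \<longrightarrow>
        (\<forall>y \<in> {1..n}. \<forall>k \<in> {0, 1}.
           (\<Sum>x \<in> {x \<in> bitstrings n. parity n x t = 0}. prob S k y x) =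
           (\<Sum>x \<in> {x \<in> bitstrings n. parity n x t = 1}. prob S k y x)))"

definition pom_scenario :: "nat \<Rightarrow> scenario \<Rightarrow> bool" where
  "pom_scenario n S \<longleftrightarrow>
     1 \<le> hdim S \<and>
     (\<forall>x \<in> bitstrings n. density_operator (hdim S) (state S x)) \<and>
     (\<forall>y \<in> {1..n}. binary_povm (hdim S) (effect S y)) \<and>
     parity_oblivious n S"

definition success_rate :: "nat \<Rightarrow> scenario \<Rightarrow> real" where
  "success_rate n S =
     1 / (2 ^ n * real n) * (\<Sum>y = 1..n. \<Sum>x \<in> bitstrings n. prob S (x y) y x)"

definition s_NC :: "nat \<Rightarrow> real" where
  "s_NC n = 1 / 2 * (1 + 1 / real n)"

definition max_mixed :: "nat \<Rightarrow> complex mat" where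
  "max_mixed d = (1 / of_nat d) \<cdot>\<^sub>m 1\<^sub>m d"

definition depolarise :: "real \<Rightarrow> scenario \<Rightarrow> scenario" where
  "depolarise r S =
     S\<lparr>state := \<lambda>x. complex_of_real (1 - r) \<cdot>\<^sub>m state S x +
                     complex_of_real r \<cdot>\<^sub>m max_mixed (hdim S)\<rparr>"

definition noncontextual_noise :: "nat \<Rightarrow> scenario \<Rightarrow> real set" where
  "noncontextual_noise n S = {r. 0 \<le> r \<and> r \<le> 1 \<and> success_rate n (depolarise r S) = s_NC n}"

text \<open>
  Meaningful only when \<open>noncontextual_noise n S\<close> has a least element; otherwise the value of
  \<open>LEAST\<close> is unspecified.
\<close>

definition r_min_depol :: "nat \<Rightarrow> scenario \<Rightarrow> real" where
  "r_min_depol n S = (LEAST r. r \<in> noncontextual_noise n S)"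

end

theory Submission
  imports Defs
begin

text \<open>
  Guessing from the maximally mixed state succeeds with probability exactly \<open>1/2\<close>: the effects of
  each measurement sum to the identity and the target bit \<open>x\<^sub>y\<close> is uniformly distributed.  By
  linearity of the trace, noise of strength \<open>r\<close> turns the success rate \<open>s\<close> into
  \<open>(1 - r) s + r / 2\<close>.  As \<open>1/2 < s\<^sub>N\<^sub>C\<close>, this equals \<open>s\<^sub>N\<^sub>C\<close> for some \<open>r \<in> [0, 1]\<close> iff
  \<open>s\<^sub>N\<^sub>C \<le> s\<close>, and \<open>r\<close> is then unique and equal to \<open>1 - (s\<^sub>N\<^sub>C - 1/2) / (s - 1/2)\<close>, which strictly
  increases with \<open>s\<close>.
\<close>

lemma mat_trace_add:
  assumes "A \<in> carrier_mat d d" "B \<in> carrier_mat d d"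
  shows "mat_trace (A + B) = mat_trace A + mat_trace B"
  using assms by (auto simp: mat_trace_def sum.distrib)

lemma mat_trace_smult:
  assumes "A \<in> carrier_mat d d"
  shows "mat_trace (c \<cdot>\<^sub>m A) = c * mat_trace A"
  using assms by (auto simp: mat_trace_def sum_distrib_left)

lemma mat_trace_one: "mat_trace (1\<^sub>m d) = of_nat d"
  by (simp add: mat_trace_def)

lemma card_bitstrings: "card (bitstrings n) = 2 ^ n"
  by (simp add: bitstrings_def card_PiE numeral_2_eq_2)

lemma bitstrings_bit: "x \<in> bitstrings n \<Longrightarrow> y \<in> {1..n} \<Longrightarrow> x y \<in> {0, 1}"
  by (auto simp: bitstrings_def PiE_def Pi_def)

text \<open>Flipping bit \<open>y\<close> is an involution of \<open>bitstrings n\<close>, so the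
  sum is unchanged when \<open>x y\<close> is replaced by its complement. Adding the two versions
  puts \<open>g 0 + g 1\<close> at each of the \<open>2 ^ n\<close> strings.\<close>

lemma sum_bitstrings_bit:
  fixes g :: "nat \<Rightarrow> real"
  assumes y: "y \<in> {1..n}"
  shows "2 * (\<Sum>x\<in>bitstrings n. g (x y)) = 2 ^ n * (g 0 + g 1)"
proof -
  define flip where "flip = (\<lambda>x :: nat \<Rightarrow> nat. x(y := 1 - x y))"
  have flip_mem: "flip x \<in> bitstrings n" if "x \<in> bitstrings n" for x
    using that bitstrings_bit[OF that y] y
    by (auto simp: flip_def bitstrings_def PiE_iff extensional_def)
  have flip_flip: "flip (flip x) = x" if "x \<in> bitstrings n" for x
    using bitstrings_bit[OF that y] by (auto simp: flip_def)
  have "(\<Sum>x\<in>bitstrings n. g (x y)) = (\<Sum>x\<in>bitstrings n. g (1 - x y))"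
  proof (rule sum.reindex_bij_witness[of _ flip flip])
    show "g (1 - flip x y) = g (x y)" if "x \<in> bitstrings n" for x
      using bitstrings_bit[OF that y] by (auto simp: flip_def)
  qed (use flip_mem flip_flip in auto)
  then have "2 * (\<Sum>x\<in>bitstrings n. g (x y)) = (\<Sum>x\<in>bitstrings n. g (x y) + g (1 - x y))"
    by (simp add: sum.distrib)
  also have "\<dots> = (\<Sum>x\<in>bitstrings n. g 0 + g 1)"
    using bitstrings_bit[OF _ y] by (intro sum.cong) force+
  finally show ?thesis
    by (simp add: card_bitstrings)
qed

text \<open>The product of an effect with the maximally mixed state is the effect scaled by the
  inverse dimension, so the noise term depends on the effect alone and not on
  \<open>x\<close>.\<close>

lemma prob_depolarise:
  assumes E: "effect S y k \<in> carrier_mat (hdim S) (hdim S)"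
    and \<rho>: "state S x \<in> carrier_mat (hdim S) (hdim S)"
  shows "prob (depolarise r S) k y x =
    (1 - r) * prob S k y x + r * (Re (mat_trace (effect S y k)) / real (hdim S))"
proof -
  let ?d = "hdim S" and ?E = "effect S y k"
  \<comment> \<open>All scalars take the form \<open>complex_of_real\<close>, so that the real part
    of the trace later splits into real multiples.\<close>
  have "?E * (complex_of_real (1 - r) \<cdot>\<^sub>m state S x + complex_of_real r \<cdot>\<^sub>m max_mixed ?d) =
      complex_of_real (1 - r) \<cdot>\<^sub>m (?E * state S x) +
      complex_of_real r \<cdot>\<^sub>m (complex_of_real (1 / real ?d) \<cdot>\<^sub>m ?E)"
    using E \<rho> unfolding max_mixed_def
    by (simp add: mult_add_distrib_mat[OF E, of _ ?d] mult_smult_distrib[OF E, of _ ?d])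
  then have "mat_trace (?E * (complex_of_real (1 - r) \<cdot>\<^sub>m state S x
        + complex_of_real r \<cdot>\<^sub>m max_mixed ?d)) =
      complex_of_real (1 - r) * mat_trace (?E * state S x) +
      complex_of_real r * (complex_of_real (1 / real ?d) * mat_trace ?E)"
    using E \<rho> by (simp only: mat_trace_add[of _ ?d] mat_trace_smult[of _ ?d]
        mult_carrier_mat[of _ ?d ?d] smult_carrier_mat)
  then show ?thesis
    by (simp add: prob_def depolarise_def)
qed

lemma success_rate_depolarise:
  assumes "1 \<le> n" and S: "pom_scenario n S"
  shows "success_rate n (depolarise r S) = (1 - r) * success_rate n S + r / 2"
proof -
  let ?d = "hdim S"
  \<comment> \<open>\<open>g y k\<close> is the probability of outcome \<open>k\<close> of the
    measurement \<open>y\<close> on the maximally mixed state.\<close>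
  define g where "g = (\<lambda>y k. Re (mat_trace (effect S y k)) / real ?d)"
  have d: "?d \<ge> 1"
    using S by (simp add: pom_scenario_def)
  have \<rho>: "state S x \<in> carrier_mat ?d ?d" if "x \<in> bitstrings n" for x
    using S that by (auto simp: pom_scenario_def density_operator_def psd_def)
  have E: "effect S y 0 \<in> carrier_mat ?d ?d" "effect S y 1 \<in> carrier_mat ?d ?d"
    and E1: "effect S y 0 + effect S y 1 = 1\<^sub>m ?d" if "y \<in> {1..n}" for y
    using S that by (auto simp: pom_scenario_def binary_povm_def psd_def)
  have "g y 0 + g y 1 = 1" if "y \<in> {1..n}" for y
  proof -
    have "mat_trace (effect S y 0) + mat_trace (effect S y 1) = of_nat ?d"
      using mat_trace_add[OF E[OF that]] E1[OF that] by (simp add: mat_trace_one)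
    then have "Re (mat_trace (effect S y 0)) + Re (mat_trace (effect S y 1)) = real ?d"
      by (metis plus_complex.simps(1) Re_complex_of_real of_real_of_nat_eq)
    then show ?thesis
      using d by (simp add: g_def flip: add_divide_distrib)
  qed
  then have uniform: "(\<Sum>x\<in>bitstrings n. g y (x y)) = 2 ^ n / 2" if "y \<in> {1..n}" for y
    using sum_bitstrings_bit[OF that, of "g y"] that by simp
  have "(\<Sum>x\<in>bitstrings n. prob (depolarise r S) (x y) y x) =
      (1 - r) * (\<Sum>x\<in>bitstrings n. prob S (x y) y x) + r * (2 ^ n / 2)" if y: "y \<in> {1..n}" for y
  proof -
    have "prob (depolarise r S) (x y) y x = (1 - r) * prob S (x y) y x + r * g y (x y)"
      if x: "x \<in> bitstrings n" for x
      unfolding g_def using bitstrings_bit[OF x y] E[OF y] \<rho>[OF x]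
      by (intro prob_depolarise) auto
    then show ?thesis
      using uniform[OF y] by (simp add: sum.distrib flip: sum_distrib_left)
  qed
  then have "(\<Sum>y = 1..n. \<Sum>x\<in>bitstrings n. prob (depolarise r S) (x y) y x) =
      (1 - r) * (\<Sum>y = 1..n. \<Sum>x\<in>bitstrings n. prob S (x y) y x) + real n * (r * (2 ^ n / 2))"
    by (simp add: sum.distrib flip: sum_distrib_left)
  then show ?thesis
    using \<open>1 \<le> n\<close> by (simp add: success_rate_def field_simps)
qed

lemma half_less_s_NC: "1 \<le> n \<Longrightarrow> 1 / 2 < s_NC n"
  by (simp add: s_NC_def field_simps)

lemma noncontextual_noise_eq:
  assumes "1 \<le> n" "pom_scenario n S"
  shows "noncontextual_noise n S =
    (if s_NC n \<le> success_rate n S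
     then {(success_rate n S - s_NC n) / (success_rate n S - 1 / 2)} else {})"
proof -
  define s c where "s = success_rate n S" and "c = s_NC n"
  have c: "1 / 2 < c"
    using half_less_s_NC[OF assms(1)] by (simp add: c_def)
  have noise: "r \<in> noncontextual_noise n S \<longleftrightarrow> 0 \<le> r \<and> r \<le> 1 \<and> (1 - r) * s + r / 2 = c" for r
    by (simp add: noncontextual_noise_def success_rate_depolarise[OF assms] s_def c_def)
  show ?thesis
  proof (cases "c \<le> s")
    case True
    \<comment> \<open>The equation reads \<open>r * (s - 1 / 2) = s - c\<close>, and 1/2 < c \<le> s
      makes the factor positive.\<close>
    then have "(1 - r) * s + r / 2 = c \<longleftrightarrow> r = (s - c) / (s - 1 / 2)" for r
      using c by (auto simp: field_simps)
    moreover have "0 \<le> (s - c) / (s - 1 / 2)" "(s - c) / (s - 1 / 2) \<le> 1"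
      using True c by (auto simp: divide_simps)
    ultimately have "noncontextual_noise n S = {(s - c) / (s - 1 / 2)}"
      using noise by auto
    then show ?thesis
      using True by (simp add: s_def c_def)
  next
    case False
    \<comment> \<open>Both \<open>s\<close> and 1/2 lie strictly below \<open>c\<close>, hence so
      does every convex combination of them.\<close>
    have "(1 - r) * s + r * (1 / 2) < c" if "0 \<le> r" "r \<le> 1" for r
      using that c False by (intro convex_bound_lt) auto
    then have "noncontextual_noise n S = {}"
      using noise by force
    then show ?thesis
      using False by (simp add: s_def c_def)
  qed
qed

text \<open>The set of admissible noise strengths is a singleton here, so \<open>LEAST\<close> is
  well defined and picks its only element.\<close>

lemma r_min_depol_eq:
  assumes "1 \<le> n" "pom_scenario n S" "s_NC n \<le> success_rate n S"
  shows "r_min_depol n S = (success_rate n S - s_NC n) / (success_rate n S - 1 / 2)"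
  unfolding r_min_depol_def noncontextual_noise_eq[OF assms(1,2)] using assms(3)
  by (intro Least_equality) auto

theorem proposition1:
  fixes n :: nat
  assumes "1 \<le> n"
  shows "(\<forall>S. pom_scenario n S \<longrightarrow>
            (noncontextual_noise n S \<noteq> {} \<longleftrightarrow> s_NC n \<le> success_rate n S)) \<and>
         (\<forall>S. pom_scenario n S \<longrightarrow> noncontextual_noise n S \<noteq> {} \<longrightarrow>
            r_min_depol n S \<in> noncontextual_noise n S \<and>
            (\<forall>r \<in> noncontextual_noise n S. r_min_depol n S \<le> r) \<and>
            r_min_depol n S = (success_rate n S - s_NC n) / (success_rate n S - 1 / 2)) \<and>
         (\<forall>S S'. pom_scenario n S \<longrightarrow> noncontextual_noise n S \<noteq> {} \<longrightarrow>
            pom_scenario n S' \<longrightarrow> noncontextual_noise n S' \<noteq> {} \<longrightarrow>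
            (r_min_depol n S < r_min_depol n S' \<longleftrightarrow> success_rate n S < success_rate n S'))"
proof -
  let ?s = "success_rate n"
  have ne: "noncontextual_noise n S \<noteq> {} \<longleftrightarrow> s_NC n \<le> ?s S" if "pom_scenario n S" for S
    using noncontextual_noise_eq[OF assms that] by simp
  have "r_min_depol n S < r_min_depol n S' \<longleftrightarrow> ?s S < ?s S'"
    if S: "pom_scenario n S" "s_NC n \<le> ?s S" and S': "pom_scenario n S'" "s_NC n \<le> ?s S'" for S S'
  proof -
    \<comment> \<open>Measured from 1/2, the robustness becomes \<open>1 - c / a\<close>, which is
      strictly increasing in \<open>a > 0\<close> because \<open>c > 0\<close>.\<close>
    define a b c where "a = ?s S - 1 / 2" and "b = ?s S' - 1 / 2" and "c = s_NC n - 1 / 2"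
    have pos: "0 < a" "0 < b" "0 < c"
      using half_less_s_NC[OF assms] S(2) S'(2) by (auto simp: a_def b_def c_def)
    have "r_min_depol n S = (a - c) / a" "r_min_depol n S' = (b - c) / b"
      using r_min_depol_eq[OF assms S] r_min_depol_eq[OF assms S']
      by (simp_all add: a_def b_def c_def)
    moreover have "(a - c) / a < (b - c) / b \<longleftrightarrow> a < b"
      using pos by (simp add: diff_divide_distrib divide_less_eq less_divide_eq)
    ultimately show ?thesis
      by (simp add: a_def b_def)
  qed
  then show ?thesis
    using ne noncontextual_noise_eq[OF assms] r_min_depol_eq[OF assms] by auto
qed

end
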